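(* Suppose that $u$ and $u_n$, $n=1,2,\ldots$, are fuzzy sets in $F_{USCG}(\mathbb{R}^m)$. Then the following statements are equivalent (all limits as $n\to\infty$). (i) $H_{\rm end}(u_n,u)\to0$. (ii) $H([u_n]_\alpha,[u]_\alpha)\to0$ holds for almost every $\alpha\in(0,1)$. (iii) $H([u_n]_\alpha,[u]_\alpha)\to0$ holds for all $\alpha\in(0,1)\setminus P(u)$. (iv) $H([u_n]_\alpha,[u]_\alpha)\to0$ holds for all $\alpha\in P$, where $P$ is some dense subset of $(0,1)\setminus P(u)$. (v) $H([u_n]_\alpha,[u]_\alpha)\to0$ holds for all $\alpha\in P$, where $P$ is some countable dense subset of $(0,1)\setminus P(u)$.
   Context: A fuzzy set on $\mathbb{R}^m$ is a function $u:\mathbb{R}^m\to[0,1]$. For $\alpha\in(0,1]$, $[u]_\alpha=\{x:u(x)\ge\alpha\}$ and $\{u>\alpha\}=\{x:u(x)>\alpha\}$. $F_{USCG}(\mathbb{R}^m)$ is the set of all upper semi-continuous fuzzy sets $u$ on $\mathbb{R}^m$ with $[u]_\alpha$ bounded for each $\alpha\in(0,1]$ (cuts may be empty). $P(u)$ is the set of platform points of $u$: those $\alpha\in(0,1)$ with $\overline{\{u>\alpha\}}\subsetneqq[u]_\alpha$. "Almost every" refers to Lebesgue measure. $H$ is the Hausdorff metric, $H(A,B)=\max\{\sup_{a\in A}\inf_{b\in B}d(a,b),\ \sup_{b\in B}\inf_{a\in A}d(a,b)\}$ for nonempty closed sets ($d$ Euclidean), extended by $H(\emptyset,\emptyset)=0$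 and $H(\emptyset,A)=H(A,\emptyset)=+\infty$ for $A\neq\emptyset$. The endograph of $u$ is ${\rm end}\,u=\{(x,t)\in\mathbb{R}^m\times[0,1]:u(x)\ge t\}$ and $H_{\rm end}(u,v)=H({\rm end}\,u,{\rm end}\,v)$. *)

theory Defs
  imports "HOL-Analysis.Analysis"
begin

definition fuzzy_set :: "('a \<Rightarrow> real) \<Rightarrow> bool" where
  "fuzzy_set u \<longleftrightarrow> (\<forall>x. u x \<in> {0..1})"

definition level_cut :: "('a \<Rightarrow> real) \<Rightarrow> real \<Rightarrow> 'a set" where
  "level_cut u \<alpha> = {x. u x \<ge> \<alpha>}"

definition strict_level_cut :: "('a \<Rightarrow> real) \<Rightarrow> real \<Rightarrow> 'a set" where
  "strict_level_cut u \<alpha> = {x. u x > \<alpha>}"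

definition upper_semicontinuous :: "('a::topological_space \<Rightarrow> real) \<Rightarrow> bool" where
  "upper_semicontinuous u \<longleftrightarrow> (\<forall>x. \<forall>c>u x. eventually (\<lambda>y. u y < c) (nhds x))"

definition F_USCG :: "('a::metric_space \<Rightarrow> real) set" where
  "F_USCG = {u. fuzzy_set u \<and> upper_semicontinuous u \<and> (\<forall>\<alpha>\<in>{0<..1}. bounded (level_cut u \<alpha>))}"

definition platform_points :: "('a::topological_space \<Rightarrow> real) \<Rightarrow> real set" where
  "platform_points u = {\<alpha>\<in>{0<..<1}. closure (strict_level_cut u \<alpha>) \<subset> level_cut u \<alpha>}"

definition endograph :: "('a \<Rightarrow> real) \<Rightarrow> ('a \<times> real) set" where
  "endograph u = {(x, t). t \<in> {0..1} \<and> u x \<ge> t}"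

text \<open>Values lie in \<^typ>\<open>ennreal\<close>, so the distance may be infinite.\<close>

definition Hausdorff :: "'a::metric_space set \<Rightarrow> 'a set \<Rightarrow> ennreal" where
  "Hausdorff A B =
     (if A = {} \<and> B = {} then 0
      else if A = {} \<or> B = {} then \<infinity>
      else max (SUP a\<in>A. INF b\<in>B. ennreal (dist a b))
               (SUP b\<in>B. INF a\<in>A. ennreal (dist a b)))"

text \<open>The product metric on \<^typ>\<open>'a \<times> real\<close> is the Euclidean one,
  \<^term>\<open>sqrt ((dist x y)\<^sup>2 + (dist s t)\<^sup>2)\<close>.\<close>

definition H_end :: "('a::metric_space \<Rightarrow> real) \<Rightarrow> ('a \<Rightarrow> real) \<Rightarrow> ennreal" where
  "H_end u v = Hausdorff (endograph u) (endograph v)"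

definition dense_subset :: "'a::topological_space set \<Rightarrow> 'a set \<Rightarrow> bool" where
  "dense_subset P S \<longleftrightarrow> P \<subseteq> S \<and> S \<subseteq> closure P"

end

theory Submission
  imports Defs
begin

text \<open>
  The whole theorem rests on two observations about a single pair of fuzzy sets.

  If the endographs of \<open>v\<close> and \<open>u\<close> are close, then every point of \<open>[v]\<^sub>\<alpha>\<close> is near some cut
  \<open>[u]\<^sub>\<beta>\<close> with \<open>\<beta>\<close> slightly below \<open>\<alpha>\<close>, and every point of a cut \<open>[u]\<^sub>\<beta>\<close> with \<open>\<beta>\<close> slightly
  above \<open>\<alpha>\<close> is near \<open>[v]\<^sub>\<alpha>\<close>. So closeness of the cuts at \<open>\<alpha>\<close> follows once the map
  \<open>\<beta> \<mapsto> [u]\<^sub>\<beta>\<close> is continuous at \<open>\<alpha>\<close> in the Hausdorff sense. Because the cuts are compact,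
  continuity from the left is automatic (\<open>level_cut_left_continuous\<close>), and continuity from the
  right holds exactly when \<open>{u > \<alpha>}\<close> is dense in \<open>[u]\<^sub>\<alpha>\<close>, that is, when \<open>\<alpha>\<close> is not a platform
  point (\<open>level_cut_right_continuous\<close>). This gives (i) \<open>\<Longrightarrow>\<close> (iii).

  Conversely, if the cuts are close at finitely many levels that are spaced finely enough in
  \<open>[0,1]\<close>, then the endographs are close (\<open>endographs_close_if_cuts_close\<close>): a point \<open>(x,t)\<close> can be
  lowered to the next such level below \<open>t\<close> and then moved within that level, and points of small
  height can be lowered to height \<open>0\<close>, where every endograph contains everything. Any dense set of
  levels contains such a finite set, by compactness. This gives (iv) \<open>\<Longrightarrow>\<close> (i).

  What remains is to see that the exceptional levels do not matter. A platform point is the value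
  of \<open>u\<close> at a local maximum, and a function on a second-countable space has only countably many
  local maximum values (\<open>countable_platform_points\<close>). Hence \<open>P(u)\<close> is a null set, which gives
  (iii) \<open>\<Longrightarrow>\<close> (ii), and a set of levels that has full measure in \<open>(0,1)\<close>, or that is
  dense in \<open>(0,1) - P(u)\<close>, is dense in \<open>(0,1)\<close>, which gives (ii) \<open>\<Longrightarrow>\<close> (iv) and lets (iv) reach all
  heights. Statement (v) lies between (iii) and (iv) because \<open>(0,1) - P(u)\<close> is separable.
\<close>

section \<open>Hausdorff convergence in terms of neighbourhoods\<close>

text \<open>Phrasing closeness by mutual approximation makes the conventions for empty sets consistent
  automatically: an empty set is close to the empty set and to nothing else.\<close>

definition hausdorff_close :: "real \<Rightarrow> 'a::metric_space set \<Rightarrow> 'a set \<Rightarrow> bool" where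
  "hausdorff_close e A B \<longleftrightarrow>
     (\<forall>a\<in>A. \<exists>b\<in>B. dist a b < e) \<and> (\<forall>b\<in>B. \<exists>a\<in>A. dist a b < e)"

lemma hausdorff_closeI:
  assumes "\<And>a. a \<in> A \<Longrightarrow> \<exists>b\<in>B. dist a b < e" and "\<And>b. b \<in> B \<Longrightarrow> \<exists>a\<in>A. dist a b < e"
  shows "hausdorff_close e A B"
  using assms unfolding hausdorff_close_def by blast

lemma hausdorff_close_commute: "hausdorff_close e A B \<longleftrightarrow> hausdorff_close e B A"
  unfolding hausdorff_close_def by (auto simp: dist_commute)

lemma hausdorff_close_if_Hausdorff_less:
  assumes "Hausdorff A B < ennreal e"
  shows "hausdorff_close e A B"
proof (cases "A = {} \<or> B = {}")
  case True
  then show ?thesis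
    using assms by (auto simp: Hausdorff_def hausdorff_close_def split: if_splits)
next
  case False
  then have sup: "(SUP a\<in>A. INF b\<in>B. ennreal (dist a b)) < ennreal e"
      "(SUP b\<in>B. INF a\<in>A. ennreal (dist a b)) < ennreal e"
    using assms by (auto simp: Hausdorff_def)
  show ?thesis
  proof (rule hausdorff_closeI)
    fix a assume "a \<in> A"
    then have "(INF b\<in>B. ennreal (dist a b)) < ennreal e"
      using sup(1) by (meson SUP_upper le_less_trans)
    then show "\<exists>b\<in>B. dist a b < e"
      by (auto simp: INF_less_iff ennreal_less_iff)
  next
    fix b assume "b \<in> B"
    then have "(INF a\<in>A. ennreal (dist a b)) < ennreal e"
      using sup(2) by (meson SUP_upper le_less_trans)
    then show "\<exists>a\<in>A. dist a b < e"
      by (auto simp: INF_less_iff ennreal_less_iff)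
  qed
qed

lemma Hausdorff_le_if_hausdorff_close:
  assumes "hausdorff_close e A B"
  shows "Hausdorff A B \<le> ennreal e"
proof (cases "A = {} \<or> B = {}")
  case True
  then show ?thesis
    using assms by (auto simp: Hausdorff_def hausdorff_close_def)
next
  case False
  have "(INF b\<in>B. ennreal (dist a b)) \<le> ennreal e" if "a \<in> A" for a
    using assms that unfolding hausdorff_close_def
    by (meson INF_lower2 ennreal_leI less_imp_le)
  moreover have "(INF a\<in>A. ennreal (dist a b)) \<le> ennreal e" if "b \<in> B" for b
    using assms that unfolding hausdorff_close_def
    by (meson INF_lower2 ennreal_leI less_imp_le)
  ultimately show ?thesis
    using False by (auto simp: Hausdorff_def intro!: SUP_least)
qed

lemma tendsto_Hausdorff_0_iff:
  "((\<lambda>n. Hausdorff (A n) B) \<longlongrightarrow> 0) F \<longleftrightarrow> (\<forall>e>0. \<forall>\<^sub>F n in F. hausdorff_close e (A n) B)"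
proof (intro iffI allI impI)
  fix e :: real
  assume lim: "((\<lambda>n. Hausdorff (A n) B) \<longlongrightarrow> 0) F" and "e > 0"
  then have "\<forall>\<^sub>F n in F. Hausdorff (A n) B < ennreal e"
    using order_tendstoD(2)[OF lim, of "ennreal e"] by simp
  then show "\<forall>\<^sub>F n in F. hausdorff_close e (A n) B"
    by (rule eventually_mono) (rule hausdorff_close_if_Hausdorff_less)
next
  assume close: "\<forall>e>0. \<forall>\<^sub>F n in F. hausdorff_close e (A n) B"
  show "((\<lambda>n. Hausdorff (A n) B) \<longlongrightarrow> 0) F"
  proof (rule order_tendstoI)
    fix c :: ennreal assume "0 < c"
    then obtain d where d: "0 < d" "d < c"
      using dense by blast
    then obtain e where e: "d = ennreal e" "e > 0"
      by (cases d) (auto simp: ennreal_zero_less_top)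
    from close e(2) have "\<forall>\<^sub>F n in F. hausdorff_close e (A n) B"
      by blast
    then show "\<forall>\<^sub>F n in F. Hausdorff (A n) B < c"
      by (rule eventually_mono)
        (metis Hausdorff_le_if_hausdorff_close d(2) e(1) le_less_trans)
  qed simp
qed

section \<open>Platform points\<close>

lemma platform_points_subset_local_maxima:
  "platform_points u \<subseteq> {\<alpha>. \<exists>U x. open U \<and> x \<in> U \<and> u x = \<alpha> \<and> (\<forall>y\<in>U. u y \<le> \<alpha>)}"
proof
  fix \<alpha> assume "\<alpha> \<in> platform_points u"
  then obtain x where x: "u x \<ge> \<alpha>" "x \<notin> closure (strict_level_cut u \<alpha>)"
    by (auto simp: platform_points_def level_cut_def)
  have below: "u y \<le> \<alpha>" if "y \<in> - closure (strict_level_cut u \<alpha>)" for y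
    using that closure_subset[of "strict_level_cut u \<alpha>"]
    by (force simp: strict_level_cut_def)
  moreover have "u x = \<alpha>"
    using x below[of x] by simp
  moreover have "open (- closure (strict_level_cut u \<alpha>))"
    by (intro open_Compl closed_closure)
  ultimately show "\<alpha> \<in> {\<alpha>. \<exists>U x. open U \<and> x \<in> U \<and> u x = \<alpha> \<and> (\<forall>y\<in>U. u y \<le> \<alpha>)}"
    using x(2) by blast
qed

text \<open>A local maximum value is the maximum of the function on some member of a countable
  base, and each member of the base has at most one maximum.\<close>

lemma countable_local_maximum_values:
  fixes u :: "'a::second_countable_topology \<Rightarrow> 'b::linorder"
  shows "countable {\<alpha>. \<exists>U x. open U \<and> x \<in> U \<and> u x = \<alpha> \<and> (\<forall>y\<in>U. u y \<le> \<alpha>)}"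
proof -
  obtain \<B> :: "'a set set" where \<B>: "countable \<B>" "topological_basis \<B>"
    using ex_countable_basis by blast
  have "{\<alpha>. \<exists>U x. open U \<and> x \<in> U \<and> u x = \<alpha> \<and> (\<forall>y\<in>U. u y \<le> \<alpha>)}
          \<subseteq> (\<lambda>B. THE \<alpha>. \<alpha> \<in> u ` B \<and> (\<forall>y\<in>B. u y \<le> \<alpha>)) ` \<B>"
  proof clarify
    fix U x assume U: "open U" "x \<in> U" "\<forall>y\<in>U. u y \<le> u x"
    then obtain B where B: "B \<in> \<B>" "x \<in> B" "B \<subseteq> U"
      using topological_basisE[OF \<B>(2)] by metis
    have "(THE \<alpha>. \<alpha> \<in> u ` B \<and> (\<forall>y\<in>B. u y \<le> \<alpha>)) = u x"
      using U(3) B by (intro the_equality) (auto intro: antisym)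
    then show "u x \<in> (\<lambda>B. THE \<alpha>. \<alpha> \<in> u ` B \<and> (\<forall>y\<in>B. u y \<le> \<alpha>)) ` \<B>"
      using B(1) by force
  qed
  then show ?thesis
    using \<B>(1) by (meson countable_image countable_subset)
qed

lemma countable_platform_points:
  fixes u :: "'a::second_countable_topology \<Rightarrow> real"
  shows "countable (platform_points u)"
  using platform_points_subset_local_maxima countable_local_maximum_values
  by (rule countable_subset)

section \<open>Continuity of the cuts in the level\<close>

lemma open_sublevel_if_upper_semicontinuous:
  assumes "upper_semicontinuous u"
  shows "open {x. u x < c}"
  using assms unfolding upper_semicontinuous_def eventually_nhds
  by (subst open_subopen) (fastforce simp: subset_iff)

lemma compact_level_cut:
  fixes u :: "'a::heine_borel \<Rightarrow> real"
  assumes "u \<in> F_USCG" and "\<alpha> \<in> {0<..1}"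
  shows "compact (level_cut u \<alpha>)"
proof -
  have "level_cut u \<alpha> = - {x. u x < \<alpha>}"
    by (auto simp: level_cut_def)
  moreover have "open {x. u x < \<alpha>}"
    using assms(1) by (intro open_sublevel_if_upper_semicontinuous) (simp add: F_USCG_def)
  ultimately have "closed (level_cut u \<alpha>)"
    by (simp add: closed_def)
  moreover have "bounded (level_cut u \<alpha>)"
    using assms by (auto simp: F_USCG_def)
  ultimately show ?thesis
    by (simp add: compact_eq_bounded_closed)
qed

text \<open>Outside the \<open>\<delta>\<close>-neighbourhood of \<open>[u]\<^sub>\<alpha>\<close>, the compact cut \<open>[u]\<^bsub>\<alpha>/2\<^esub>\<close> is covered by the
  open sets \<open>{u < c}\<close> with \<open>c < \<alpha>\<close>, hence by finitely many of them; so \<open>u\<close> stays below a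
  level smaller than \<open>\<alpha>\<close> there. The argument includes the case that \<open>[u]\<^sub>\<alpha>\<close> is empty, in which
  the conclusion says that already a lower cut is empty.\<close>

lemma level_cut_left_continuous:
  fixes u :: "'a::heine_borel \<Rightarrow> real"
  assumes u: "u \<in> F_USCG" and \<alpha>: "\<alpha> \<in> {0<..1}" and "\<delta> > 0"
  obtains \<beta> where "0 < \<beta>" "\<beta> < \<alpha>" "\<forall>y\<in>level_cut u \<beta>. \<exists>x\<in>level_cut u \<alpha>. dist y x < \<delta>"
proof -
  define N where "N = (\<Union>x\<in>level_cut u \<alpha>. ball x \<delta>)"
  have "open N"
    by (auto simp: N_def)
  have "compact (level_cut u (\<alpha>/2) - N)"
    using compact_level_cut[OF u, of "\<alpha>/2"] \<alpha> \<open>open N\<close> by (intro compact_diff) auto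
  moreover have "\<And>c. c \<in> {..<\<alpha>} \<Longrightarrow> open {x. u x < c}"
    using u by (intro open_sublevel_if_upper_semicontinuous) (simp add: F_USCG_def)
  moreover have "level_cut u (\<alpha>/2) - N \<subseteq> (\<Union>c\<in>{..<\<alpha>}. {x. u x < c})"
  proof
    fix x assume "x \<in> level_cut u (\<alpha>/2) - N"
    then have "x \<notin> level_cut u \<alpha>"
      using \<open>\<delta> > 0\<close> by (force simp: N_def)
    then have "u x < \<alpha>"
      by (simp add: level_cut_def)
    then show "x \<in> (\<Union>c\<in>{..<\<alpha>}. {x. u x < c})"
      using dense by auto
  qed
  ultimately obtain C where C: "C \<subseteq> {..<\<alpha>}" "finite C"
      "level_cut u (\<alpha>/2) - N \<subseteq> (\<Union>c\<in>C. {x. u x < c})"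
    by (rule compactE_image)
  define \<beta> where "\<beta> = Max (insert (\<alpha>/2) C)"
  have "\<beta> \<in> insert (\<alpha>/2) C"
    using C(2) unfolding \<beta>_def by (intro Max_in) auto
  then have "\<beta> < \<alpha>"
    using C(1) \<alpha> by auto
  have \<beta>: "c \<le> \<beta>" if "c \<in> insert (\<alpha>/2) C" for c
    using C(2) that unfolding \<beta>_def by (intro Max_ge) auto
  have "level_cut u \<beta> \<subseteq> N"
  proof
    fix y assume y: "y \<in> level_cut u \<beta>"
    show "y \<in> N"
    proof (rule ccontr)
      assume "y \<notin> N"
      moreover have "y \<in> level_cut u (\<alpha>/2)"
        using y \<beta>[of "\<alpha>/2"] by (simp add: level_cut_def)
      ultimately obtain c where "c \<in> C" "u y < c"
        using C(3) by auto
      then show False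
        using y \<beta>[of c] by (simp add: level_cut_def)
    qed
  qed
  then have "\<forall>y\<in>level_cut u \<beta>. \<exists>x\<in>level_cut u \<alpha>. dist y x < \<delta>"
    by (auto simp: N_def dist_commute subset_iff)
  moreover have "0 < \<beta>"
    using \<beta>[of "\<alpha>/2"] \<alpha> by simp
  ultimately show thesis
    using that \<open>\<beta> < \<alpha>\<close> by blast
qed

text \<open>Off the platform points, \<open>{u > \<alpha>}\<close> contains a finite \<open>\<delta>\<close>-net of the compact set
  \<open>[u]\<^sub>\<alpha>\<close>, and the smallest of the finitely many values of \<open>u\<close> on the net exceeds \<open>\<alpha>\<close>.\<close>

lemma level_cut_right_continuous:
  fixes u :: "'a::heine_borel \<Rightarrow> real"
  assumes u: "u \<in> F_USCG" and \<alpha>: "\<alpha> \<in> {0<..<1} - platform_points u" and "\<delta> > 0"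
  obtains \<beta> where "\<alpha> < \<beta>" "\<beta> \<le> 1" "\<forall>x\<in>level_cut u \<alpha>. \<exists>y\<in>level_cut u \<beta>. dist y x < \<delta>"
proof -
  have "compact (level_cut u \<alpha>)"
    using u \<alpha> by (intro compact_level_cut) auto
  moreover have "level_cut u \<alpha> \<subseteq> (\<Union>y\<in>strict_level_cut u \<alpha>. ball y \<delta>)"
  proof
    have "closure (strict_level_cut u \<alpha>) \<subseteq> level_cut u \<alpha>"
      using compact_imp_closed[OF \<open>compact (level_cut u \<alpha>)\<close>]
      by (intro closure_minimal) (auto simp: strict_level_cut_def level_cut_def)
    with \<alpha> have dense: "closure (strict_level_cut u \<alpha>) = level_cut u \<alpha>"
      by (auto simp: platform_points_def psubset_eq)
    fix x assume "x \<in> level_cut u \<alpha>"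
    then have "\<exists>y\<in>strict_level_cut u \<alpha>. dist y x < \<delta>"
      using dense \<open>\<delta> > 0\<close> closure_approachable by blast
    then show "x \<in> (\<Union>y\<in>strict_level_cut u \<alpha>. ball y \<delta>)"
      by auto
  qed
  ultimately obtain Y where Y: "Y \<subseteq> strict_level_cut u \<alpha>" "finite Y"
      "level_cut u \<alpha> \<subseteq> (\<Union>y\<in>Y. ball y \<delta>)"
    using compactE_image[of "level_cut u \<alpha>" "strict_level_cut u \<alpha>" "\<lambda>y. ball y \<delta>"] by auto
  \<comment> \<open>The extra value 1 keeps the minimum defined when the net is empty.\<close>
  define \<beta> where "\<beta> = Min (insert 1 (u ` Y))"
  have "\<beta> \<in> insert 1 (u ` Y)"
    using Y(2) unfolding \<beta>_def by (intro Min_in) auto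
  then have "\<alpha> < \<beta>"
    using Y(1) \<alpha> by (auto simp: strict_level_cut_def)
  have \<beta>: "\<beta> \<le> c" if "c \<in> insert 1 (u ` Y)" for c
    using Y(2) that unfolding \<beta>_def by (intro Min_le) auto
  have "\<forall>x\<in>level_cut u \<alpha>. \<exists>y\<in>level_cut u \<beta>. dist y x < \<delta>"
  proof
    fix x assume "x \<in> level_cut u \<alpha>"
    then obtain y where "y \<in> Y" "dist y x < \<delta>"
      using Y(3) by auto
    then show "\<exists>y\<in>level_cut u \<beta>. dist y x < \<delta>"
      using \<beta>[of "u y"] by (auto simp: level_cut_def)
  qed
  then show thesis
    using that \<open>\<alpha> < \<beta>\<close> \<beta>[of 1] by blast
qed

section \<open>Endographs and cuts\<close>

text \<open>Moving between \<open>e\<close>-close endographs costs less than \<open>e\<close> in the base point and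
  less than \<open>e\<close> in height, so a loss of \<open>e\<close> in the level is all that has to be allowed for.\<close>

lemma near_lower_cut_if_endographs_close:
  assumes close: "hausdorff_close e (endograph v) (endograph w)"
    and "t \<in> {0..1}" and "x \<in> level_cut v t" and "s \<le> t - e"
  shows "\<exists>y\<in>level_cut w s. dist x y < e"
proof -
  have "(x, t) \<in> endograph v"
    using assms by (simp add: endograph_def level_cut_def)
  then obtain y r where yr: "(y, r) \<in> endograph w" "dist (x, t) (y, r) < e"
    using close unfolding hausdorff_close_def by fast
  have "dist x y < e" "dist t r < e"
    using yr(2) dist_fst_le[of "(x, t)" "(y, r)"] dist_snd_le[of "(x, t)" "(y, r)"] by auto
  moreover from \<open>dist t r < e\<close> have "s \<le> r"
    using \<open>s \<le> t - e\<close> by (simp add: dist_real_def)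
  ultimately have "y \<in> level_cut w s"
    using yr(1) by (simp add: endograph_def level_cut_def)
  with \<open>dist x y < e\<close> show ?thesis
    by blast
qed

lemma cuts_close_if_endographs_close:
  fixes u :: "'a::heine_borel \<Rightarrow> real"
  assumes u: "u \<in> F_USCG" and \<alpha>: "\<alpha> \<in> {0<..<1} - platform_points u" and "\<delta> > 0"
  obtains e where "e > 0"
    "\<And>v. hausdorff_close e (endograph v) (endograph u)
       \<Longrightarrow> hausdorff_close \<delta> (level_cut v \<alpha>) (level_cut u \<alpha>)"
proof -
  obtain \<beta> where \<beta>: "0 < \<beta>" "\<beta> < \<alpha>"
      "\<forall>y\<in>level_cut u \<beta>. \<exists>x\<in>level_cut u \<alpha>. dist y x < \<delta>/2"
    using level_cut_left_continuous[OF u, of \<alpha> "\<delta>/2"] \<alpha> \<open>\<delta> > 0\<close> by auto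
  obtain \<gamma> where \<gamma>: "\<alpha> < \<gamma>" "\<gamma> \<le> 1"
      "\<forall>x\<in>level_cut u \<alpha>. \<exists>y\<in>level_cut u \<gamma>. dist y x < \<delta>/2"
    using level_cut_right_continuous[OF u \<alpha>, of "\<delta>/2"] \<open>\<delta> > 0\<close> by auto
  define e where "e = min (\<delta>/2) (min (\<alpha> - \<beta>) (\<gamma> - \<alpha>))"
  have e: "e > 0" "e \<le> \<delta>/2" "e \<le> \<alpha> - \<beta>" "e \<le> \<gamma> - \<alpha>"
    using \<beta>(2) \<gamma>(1) \<open>\<delta> > 0\<close> unfolding e_def by (auto simp: min_def)
  have "hausdorff_close \<delta> (level_cut v \<alpha>) (level_cut u \<alpha>)"
    if close: "hausdorff_close e (endograph v) (endograph u)" for v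
  proof (rule hausdorff_closeI)
    fix x assume "x \<in> level_cut v \<alpha>"
    then obtain y where y: "y \<in> level_cut u \<beta>" "dist x y < e"
      using near_lower_cut_if_endographs_close[OF close, of \<alpha> x \<beta>] \<alpha> e by auto
    with \<beta>(3) obtain z where z: "z \<in> level_cut u \<alpha>" "dist y z < \<delta>/2"
      by blast
    have "dist x z < \<delta>"
      using dist_triangle[of x z y] y(2) z(2) e(2) by linarith
    with z(1) show "\<exists>z\<in>level_cut u \<alpha>. dist x z < \<delta>"
      by blast
  next
    fix x assume "x \<in> level_cut u \<alpha>"
    with \<gamma>(3) obtain y where y: "y \<in> level_cut u \<gamma>" "dist y x < \<delta>/2"
      by blast
    moreover have "hausdorff_close e (endograph u) (endograph v)"
      using close by (simp add: hausdorff_close_commute)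
    ultimately obtain z where z: "z \<in> level_cut v \<alpha>" "dist y z < e"
      using near_lower_cut_if_endographs_close[of e u v \<gamma> y \<alpha>] \<alpha> \<gamma>(1,2) e by auto
    have "dist z x < \<delta>"
      using dist_triangle[of z x y] y(2) z(2) e(2) by (simp add: dist_commute)
    with z(1) show "\<exists>z\<in>level_cut v \<alpha>. dist z x < \<delta>"
      by blast
  qed
  with e(1) that show thesis
    by blast
qed

text \<open>The factor 2 comes from a loss of less than \<open>e\<close> in height, when a point is lowered to a
  level in \<open>A\<close>, and of less than \<open>e\<close> in the base point, when it is moved within that level.\<close>

lemma endograph_near_if_cuts_close:
  assumes A: "A \<subseteq> {0..1}" "\<And>t. t \<in> {e..1} \<Longrightarrow> \<exists>\<alpha>\<in>A. t - e < \<alpha> \<and> \<alpha> < t"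
    and close: "\<And>\<alpha>. \<alpha> \<in> A \<Longrightarrow> hausdorff_close e (level_cut v \<alpha>) (level_cut w \<alpha>)"
    and "fuzzy_set w" and "e > 0" and p: "p \<in> endograph v"
  shows "\<exists>q\<in>endograph w. dist p q < 2 * e"
proof -
  obtain x t where xt: "p = (x, t)" "t \<in> {0..1}" "v x \<ge> t"
    using p by (auto simp: endograph_def)
  show ?thesis
  proof (cases "t < e")
    case True
    have "(x, 0) \<in> endograph w"
      using \<open>fuzzy_set w\<close> by (simp add: endograph_def fuzzy_set_def)
    moreover have "dist p (x, 0) < 2 * e"
      using True xt(2) by (simp add: xt(1) dist_Pair_Pair dist_real_def)
    ultimately show ?thesis
      by blast
  next
    case False
    then obtain \<alpha> where \<alpha>: "\<alpha> \<in> A" "t - e < \<alpha>" "\<alpha> < t"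
      using A(2)[of t] xt(2) by auto
    have "x \<in> level_cut v \<alpha>"
      using xt(3) \<alpha>(3) by (simp add: level_cut_def)
    then obtain y where y: "y \<in> level_cut w \<alpha>" "dist x y < e"
      using close[OF \<alpha>(1)] unfolding hausdorff_close_def by blast
    have "dist p (y, \<alpha>) \<le> dist x y + dist t \<alpha>"
      using sqrt_sum_squares_le_sum[of "dist x y" "dist t \<alpha>"] by (simp add: xt(1) dist_Pair_Pair)
    also have "\<dots> < 2 * e"
      using y(2) \<alpha>(2,3) by (simp add: dist_real_def)
    finally have "dist p (y, \<alpha>) < 2 * e" .
    moreover have "(y, \<alpha>) \<in> endograph w"
      using y(1) A(1) \<alpha>(1) by (auto simp: endograph_def level_cut_def)
    ultimately show ?thesis
      by blast
  qed
qed

lemma endographs_close_if_cuts_close: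
  assumes "A \<subseteq> {0..1}" "\<And>t. t \<in> {e..1} \<Longrightarrow> \<exists>\<alpha>\<in>A. t - e < \<alpha> \<and> \<alpha> < t"
    and close: "\<And>\<alpha>. \<alpha> \<in> A \<Longrightarrow> hausdorff_close e (level_cut v \<alpha>) (level_cut u \<alpha>)"
    and "fuzzy_set v" "fuzzy_set u" and "e > 0"
  shows "hausdorff_close (2 * e) (endograph v) (endograph u)"
proof (rule hausdorff_closeI)
  fix p assume "p \<in> endograph v"
  with assms show "\<exists>q\<in>endograph u. dist p q < 2 * e"
    by (intro endograph_near_if_cuts_close) auto
next
  fix q assume "q \<in> endograph u"
  moreover have "\<And>\<alpha>. \<alpha> \<in> A \<Longrightarrow> hausdorff_close e (level_cut u \<alpha>) (level_cut v \<alpha>)"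
    using close hausdorff_close_commute by blast
  ultimately have "\<exists>p\<in>endograph v. dist q p < 2 * e"
    using assms by (intro endograph_near_if_cuts_close[of A e u v]) auto
  then show "\<exists>p\<in>endograph v. dist p q < 2 * e"
    by (simp add: dist_commute)
qed

section \<open>Dense sets of levels\<close>

lemma dense_subset_meets_interval:
  fixes P Q :: "real set"
  assumes P: "dense_subset P ({0<..<1} - Q)" and "countable Q" and "0 \<le> a" "a < b" "b \<le> 1"
  shows "\<exists>\<alpha>\<in>P. a < \<alpha> \<and> \<alpha> < b"
proof -
  have "\<not> {a<..<b} \<subseteq> Q"
    using countable_subset[of "{a<..<b}" Q] \<open>countable Q\<close> uncountable_open_interval[of a b] \<open>a < b\<close>
    by blast
  then obtain s where s: "s \<in> {a<..<b}" "s \<notin> Q"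
    by blast
  then have "s \<in> {a<..<b} \<inter> closure P"
    using P \<open>0 \<le> a\<close> \<open>b \<le> 1\<close> by (auto simp: dense_subset_def subset_iff)
  then have "{a<..<b} \<inter> P \<noteq> {}"
    using open_Int_closure_eq_empty[of "{a<..<b}" P] by auto
  then show ?thesis
    by auto
qed

text \<open>The intervals \<open>(\<alpha>, \<alpha> + e)\<close> with \<open>\<alpha>\<close> in the dense set cover the compact interval
  \<open>[e, 1]\<close>; the left endpoints of a finite subcover are the required levels.\<close>

lemma finite_fine_subset_of_dense_subset:
  fixes P Q :: "real set"
  assumes P: "dense_subset P ({0<..<1} - Q)" and "countable Q" and "e > 0"
  obtains A where "finite A" "A \<subseteq> P" "\<And>t. t \<in> {e..1} \<Longrightarrow> \<exists>\<alpha>\<in>A. t - e < \<alpha> \<and> \<alpha> < t"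
proof -
  have "{e..1} \<subseteq> (\<Union>\<alpha>\<in>P. {\<alpha><..<\<alpha> + e})"
  proof
    fix t assume "t \<in> {e..1}"
    then obtain \<alpha> where "\<alpha> \<in> P" "t - e < \<alpha>" "\<alpha> < t"
      using dense_subset_meets_interval[OF P \<open>countable Q\<close>, of "t - e" t] \<open>e > 0\<close> by auto
    then show "t \<in> (\<Union>\<alpha>\<in>P. {\<alpha><..<\<alpha> + e})"
      by force
  qed
  then obtain A where A: "A \<subseteq> P" "finite A" "{e..1} \<subseteq> (\<Union>\<alpha>\<in>A. {\<alpha><..<\<alpha> + e})"
    using compactE_image[of "{e..1}" P "\<lambda>\<alpha>. {\<alpha><..<\<alpha> + e}"] by auto
  show thesis
  proof (rule that[OF A(2,1)])
    fix t assume "t \<in> {e..1}"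
    with A(3) obtain \<alpha> where "\<alpha> \<in> A" "\<alpha> < t" "t < \<alpha> + e"
      by force
    then show "\<exists>\<alpha>\<in>A. t - e < \<alpha> \<and> \<alpha> < t"
      by force
  qed
qed

lemma countable_dense_subset_exists:
  fixes S :: "'a::{metric_space, second_countable_topology} set"
  obtains P where "countable P" "dense_subset P S"
  using separable[of S] unfolding dense_subset_def by metis

lemma AE_lebesgue_not_in_countable:
  fixes Q :: "'a::euclidean_space set"
  assumes "countable Q"
  shows "AE x in lebesgue. x \<notin> Q"
  using assms by (intro AE_completion AE_not_in countable_imp_null_set_lborel)

text \<open>A point outside the closure would have a neighbourhood on which the property fails almost
  everywhere, but nonempty open sets have positive measure.\<close>

lemma dense_subset_if_AE:
  fixes Q :: "real set"
  assumes ae: "AE \<alpha> in lebesgue. \<alpha> \<in> {0<..<1} \<longrightarrow> C \<alpha>" and "countable Q"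
  shows "dense_subset {\<alpha> \<in> {0<..<1} - Q. C \<alpha>} ({0<..<1} - Q)"
proof -
  let ?P = "{\<alpha> \<in> {0<..<1} - Q. C \<alpha>}"
  have "AE \<alpha> in lebesgue. \<alpha> \<notin> Q"
    using \<open>countable Q\<close> by (rule AE_lebesgue_not_in_countable)
  with ae have "AE \<alpha> in lebesgue. \<alpha> \<in> {0<..<1} \<longrightarrow> \<alpha> \<in> ?P"
    by eventually_elim auto
  then obtain N where N: "N \<in> null_sets lebesgue" "{\<alpha>. \<not> (\<alpha> \<in> {0<..<1} \<longrightarrow> \<alpha> \<in> ?P)} \<subseteq> N"
    by (auto simp: eventually_ae_filter)
  have "{0<..<1} - Q \<subseteq> closure ?P"
  proof
    fix s assume s: "s \<in> {0<..<1} - Q"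
    show "s \<in> closure ?P"
    proof (rule ccontr)
      assume "s \<notin> closure ?P"
      define W where "W = {0<..<1} \<inter> - closure ?P"
      have "W \<subseteq> N"
        using N(2) closure_subset[of ?P] unfolding W_def by blast
      then have "negligible W"
        using N(1) negligible_subset negligible_iff_null_sets by blast
      moreover have "open W"
        unfolding W_def by (intro open_Int) auto
      moreover have "s \<in> W"
        using s \<open>s \<notin> closure ?P\<close> by (simp add: W_def)
      ultimately show False
        using open_not_negligible by blast
    qed
  qed
  then show ?thesis
    by (auto simp: dense_subset_def)
qed

section \<open>Equivalence of the modes of convergence\<close>

lemma cuts_tendsto_if_endographs_tendsto:
  fixes u :: "'a::heine_borel \<Rightarrow> real"
  assumes u: "u \<in> F_USCG" and \<alpha>: "\<alpha> \<in> {0<..<1} - platform_points u"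
    and lim: "((\<lambda>n. H_end (w n) u) \<longlongrightarrow> 0) F"
  shows "((\<lambda>n. Hausdorff (level_cut (w n) \<alpha>) (level_cut u \<alpha>)) \<longlongrightarrow> 0) F"
  unfolding tendsto_Hausdorff_0_iff
proof (intro allI impI)
  fix \<delta> :: real assume "\<delta> > 0"
  then obtain e where e: "e > 0"
    "\<And>v. hausdorff_close e (endograph v) (endograph u)
       \<Longrightarrow> hausdorff_close \<delta> (level_cut v \<alpha>) (level_cut u \<alpha>)"
    using cuts_close_if_endographs_close[OF u \<alpha>] by metis
  have "\<forall>\<^sub>F n in F. hausdorff_close e (endograph (w n)) (endograph u)"
    using lim e(1) by (simp add: H_end_def tendsto_Hausdorff_0_iff)
  then show "\<forall>\<^sub>F n in F. hausdorff_close \<delta> (level_cut (w n) \<alpha>) (level_cut u \<alpha>)"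
    by (rule eventually_mono) (rule e(2))
qed

lemma endographs_tendsto_if_cuts_tendsto:
  fixes u :: "'a::metric_space \<Rightarrow> real"
  assumes P: "dense_subset P ({0<..<1} - Q)" and "countable Q"
    and lim: "\<And>\<alpha>. \<alpha> \<in> P \<Longrightarrow> ((\<lambda>n. Hausdorff (level_cut (w n) \<alpha>) (level_cut u \<alpha>)) \<longlongrightarrow> 0) F"
    and w: "\<forall>\<^sub>F n in F. fuzzy_set (w n)" and u: "fuzzy_set u"
  shows "((\<lambda>n. H_end (w n) u) \<longlongrightarrow> 0) F"
  unfolding H_end_def tendsto_Hausdorff_0_iff
proof (intro allI impI)
  fix e :: real assume "e > 0"
  then have "e/2 > 0"
    by simp
  then obtain A where A: "finite A" "A \<subseteq> P" "\<And>t. t \<in> {e/2..1} \<Longrightarrow> \<exists>\<alpha>\<in>A. t - e/2 < \<alpha> \<and> \<alpha> < t"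
    using finite_fine_subset_of_dense_subset[OF P \<open>countable Q\<close>] by metis
  have "A \<subseteq> {0..1}"
    using A(2) P by (auto simp: dense_subset_def subset_iff less_imp_le)
  have "\<forall>\<alpha>\<in>A. \<forall>\<^sub>F n in F. hausdorff_close (e/2) (level_cut (w n) \<alpha>) (level_cut u \<alpha>)"
    using lim A(2) \<open>e/2 > 0\<close> unfolding tendsto_Hausdorff_0_iff by blast
  then have "\<forall>\<^sub>F n in F. \<forall>\<alpha>\<in>A. hausdorff_close (e/2) (level_cut (w n) \<alpha>) (level_cut u \<alpha>)"
    using A(1) by (simp add: eventually_ball_finite)
  with w show "\<forall>\<^sub>F n in F. hausdorff_close e (endograph (w n)) (endograph u)"
  proof eventually_elim
    case (elim n)
    then show ?case
      using endographs_close_if_cuts_close[of A "e/2" "w n" u] \<open>A \<subseteq> {0..1}\<close> A(3) u \<open>e/2 > 0\<close> by simp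
  qed
qed

theorem theorem6p4:
  fixes u :: "real ^ 'm \<Rightarrow> real"
    and u_seq :: "nat \<Rightarrow> real ^ 'm \<Rightarrow> real"
  assumes "u \<in> F_USCG"
    and "\<And>n. n \<ge> 1 \<Longrightarrow> u_seq n \<in> F_USCG"
  defines "i \<equiv> (\<lambda>n. H_end (u_seq n) u) \<longlonglongrightarrow> 0"
    and "conv \<equiv> \<lambda>\<alpha>. (\<lambda>n. Hausdorff (level_cut (u_seq n) \<alpha>) (level_cut u \<alpha>)) \<longlonglongrightarrow> 0"
  defines "ii \<equiv> AE \<alpha> in lebesgue. \<alpha> \<in> {0<..<1} \<longrightarrow> conv \<alpha>"
    and "iii \<equiv> \<forall>\<alpha>\<in>{0<..<1} - platform_points u. conv \<alpha>"
    and "iv \<equiv> \<exists>P. dense_subset P ({0<..<1} - platform_points u) \<and> (\<forall>\<alpha>\<in>P. conv \<alpha>)"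
    and "v \<equiv> \<exists>P. countable P \<and> dense_subset P ({0<..<1} - platform_points u) \<and> (\<forall>\<alpha>\<in>P. conv \<alpha>)"
  shows "(i \<longleftrightarrow> ii) \<and> (ii \<longleftrightarrow> iii) \<and> (iii \<longleftrightarrow> iv) \<and> (iv \<longleftrightarrow> v)"
proof -
  have countable: "countable (platform_points u)"
    by (rule countable_platform_points)
  have fuzzy: "fuzzy_set u" "\<forall>\<^sub>F n in sequentially. fuzzy_set (u_seq n)"
    using assms(1,2) by (auto simp: F_USCG_def intro: eventually_sequentiallyI[of 1])
  have "iii" if "i"
    using that cuts_tendsto_if_endographs_tendsto[OF assms(1)] unfolding i_def iii_def conv_def
    by blast
  moreover have "ii" if "iii"
  proof -
    have "AE \<alpha> in lebesgue. \<alpha> \<notin> platform_points u"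
      using countable by (rule AE_lebesgue_not_in_countable)
    then show ?thesis
      unfolding ii_def by eventually_elim (use that[unfolded iii_def] in blast)
  qed
  moreover have "v" if "iii"
  proof -
    obtain P where "countable P" "dense_subset P ({0<..<1} - platform_points u)"
      using countable_dense_subset_exists by blast
    with that show ?thesis
      unfolding v_def iii_def dense_subset_def by blast
  qed
  moreover have "iv" if "v"
    using that unfolding v_def iv_def by blast
  moreover have "iv" if "ii"
    using dense_subset_if_AE[OF that[unfolded ii_def] countable] unfolding iv_def by blast
  moreover have "i" if "iv"
    using that endographs_tendsto_if_cuts_tendsto[OF _ countable _ fuzzy(2,1)]
    unfolding i_def iv_def conv_def by blast
  ultimately show ?thesis
    by blast
qed

end
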